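(* Let $b\in\mathbb{Z}$, $b\neq 0$, let $j\ge 0$ and $k\geq j$ be integers, and put $r=k+2$. Then $$Z_k^{\mathrm{SU}(2)}(M^b,L_j)=\exp\left(\frac{\pi i b}{2r}\right)\left(\sqrt{\frac{r}{2|b|}}\,e^{-\pi i\,\mathrm{sgn}(b)/4}\left[\sum_{n=0}^{|b|-1}\exp\left(2\pi i r\frac{n^2}{b}\right)\sum_{l=0}^{j}\exp\left(2\pi i\left(\frac{(2l-j)^2}{4br}+\frac{(2l-j)n}{b}\right)\right)\right]-\frac{j+1}{2}-\frac{(-1)^j(j+1)}{2}\exp\left(-\frac{\pi i}{2}br\right)\right).$$
   Context: Let $\Sigma=S^1\times S^1$, $\mu=\{1\}\times S^1$, and let $t_\mu=\begin{pmatrix}1&-1\\0&1\end{pmatrix}\in \mathrm{SL}(2,\mathbb{Z})\cong\mathrm{MCG}(\Sigma)$ be the left Dehn twist about $\mu$. For a homeomorphism $\phi$ of $\Sigma$, the mapping torus is $T_\phi=(\Sigma\times[0,1])/(x,0)\sim(\phi(x),1)$, and $M^b=T_{t_\mu^b}$. $Z_k^{\mathrm{SU}(2)}$ is the level $k$ Witten--Reshetikhin--Turaev $\mathrm{SU}(2)$-invariant of closed oriented 3-manifolds containing coloured framed links, in the normalization of Blanchet's Homflypt skein TQFT with parameters $a=\exp(-2\pi i/(4r))$, $s=a^{-2}$, $v=s^{-2}$, $r=k+2$. Colours are integers $0\le n\le k$ (the Young diagram with one row of $n$ cells, corresponding to the $(n+1)$-dimensional irreducible representation of $\mathrm{SU}(2)$).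 $L_j$ is a $j$-coloured knot in $M^b$ which is a parallel copy of the curve $\mu$ lying in a fibre $\Sigma\times\{t\}$ (parallel to the meridinal curve used in the surgery description of the mapping cylinder of $t_\mu$). Concretely, the TQFT vector space $V_k(\Sigma)$ is a quotient of the Homflypt skein module of the solid torus $D^2\times S^1$ and has basis $\hat y_n$, $0\le n\le k$ (the core of $D^2\times S^1$ coloured by $n$). In this basis the quantum representation $\rho_k(t_\mu)$ is diagonal with entries $a^{n^2+2n}$. Adding $L_j$ corresponds to the curve operator $C_j$, which encircles $\hat y_n$ by a meridinal unknot coloured by $j$; it is diagonal with eigenvalue $\dfrac{a^{2(n+1)(j+1)}-a^{-2(n+1)(j+1)}}{a^{2(n+1)}-a^{-2(n+1)}}$ on $\hat y_n$. The invariant is $Z_k^{\mathrm{SU}(2)}(M^b,L_j)=\mathrm{tr}\big(\rho_k(t_\mu)^b\,C_j\big)$. Invariants depend on a 2-framing only through a root-of-unity-type scalar (the framing anomaly); it is fixed here by this explicit normalization. *)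

theory Defs
  imports Complex_Main "Jordan_Normal_Form.Matrix"
begin

text \<open>
  Everything takes place on the state space \<open>V\<^sub>k(\<Sigma>)\<close> of the torus, identified with
  \<open>\<complex>\<^bsup>k+1\<^esup>\<close> by the basis \<open>y\<^sub>0, \<dots>, y\<^sub>k\<close>, where \<open>y\<^sub>n\<close> is the core of the solid torus
  \<open>D\<^sup>2 \<times> S\<^sup>1\<close> coloured by \<open>n\<close>. Endomorphisms are matrices with respect to this basis.
\<close>

text \<open>The skein parameter \<open>a\<close> is a primitive \<open>4r\<close>-th root of unity, with \<open>r = k + 2\<close>.\<close>

definition skein_a :: "nat \<Rightarrow> complex" where
  "skein_a k = exp (- (2 * complex_of_real pi * \<i>) / (4 * of_nat (k + 2)))"

text \<open>
  The image of the left Dehn twist about \<open>\<mu> = {1} \<times> S\<^sup>1\<close>. The exponent \<open>n\<^sup>2 + 2n\<close> is the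
  framing-twist coefficient of a strand coloured by \<open>n\<close>; in general a quantum representation is only
  projective, and this choice of scalars also fixes the framing anomaly.
\<close>

definition rho_twist :: "nat \<Rightarrow> complex mat" where
  "rho_twist k = mat_diag (k + 1) (\<lambda>n. skein_a k ^ (n\<^sup>2 + 2 * n))"

text \<open>
  The operator of the \<open>j\<close>-coloured curve parallel to \<open>\<mu>\<close>, which encircles the core by a
  meridional unknot coloured by \<open>j\<close>. The denominators do not vanish, because \<open>0 < n + 1 < r\<close>.
\<close>

definition curve_operator :: "nat \<Rightarrow> nat \<Rightarrow> complex mat" where
  "curve_operator k j = mat_diag (k + 1) (\<lambda>n.
     (skein_a k powi (2 * (int n + 1) * (int j + 1)) - skein_a k powi (- 2 * (int n + 1) * (int j + 1)))
     / (skein_a k powi (2 * (int n + 1)) - skein_a k powi (- 2 * (int n + 1))))"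

definition mat_trace :: "'a :: comm_monoid_add mat \<Rightarrow> 'a" where
  "mat_trace A = (\<Sum>i<dim_row A. A $$ (i, i))"

text \<open>
  The invariant of a mapping torus of \<open>\<Sigma>\<close> containing a \<open>j\<close>-coloured copy of \<open>\<mu>\<close> in a fibre,
  when the monodromy acts on \<open>V\<^sub>k(\<Sigma>)\<close> by \<open>A\<close>: gluing the ends of a cylinder amounts to taking
  the trace.
\<close>

definition Z_mapping_torus :: "nat \<Rightarrow> complex mat \<Rightarrow> nat \<Rightarrow> complex" where
  "Z_mapping_torus k A j = mat_trace (A * curve_operator k j)"

text \<open>
  The invariant of \<open>(M\<^sup>b, L\<^sub>j)\<close>, where \<open>M\<^sup>b\<close> is the mapping torus of the \<open>b\<close>-th power of the
  Dehn twist. The power is the integer power of the multiplicative monoid of matrices, so for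
  \<open>b < 0\<close> it involves the matrix inverse of an invertible matrix.
\<close>

definition Z_SU2 :: "nat \<Rightarrow> int \<Rightarrow> nat \<Rightarrow> complex" where
  "Z_SU2 k b j =
     Z_mapping_torus k (rho_twist k [^]\<^bsub>ring_mat TYPE(complex) (k + 1) ()\<^esub> b) j"

end

theory Submission
  imports
    Defs
    "HOL-Probability.Characteristic_Functions"
    "HOL-Complex_Analysis.Residue_Theorem"
    "HOL-Real_Asymp.Real_Asymp"
begin

text \<open>
Both operators are diagonal, so the trace is a finite sum over the colours. With \<open>m = n + 1\<close> the twist
contributes \<open>exp (- \<pi> \<i> b (m\<^sup>2 - 1) / (2 r))\<close>, and the quotient that defines the curve operator
is the character of the representation of dimension \<open>j + 1\<close>, a sum of \<open>exp (- \<pi> \<i> m w / r)\<close>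
over its weights \<open>w = 2 l - j\<close>. The factor \<open>exp (\<pi> \<i> b / (2 r))\<close> comes out, and what
remains is a sum of \<open>f m\<close> over \<open>0 < m < r\<close>, where \<open>f\<close> is even and has period
\<open>2 r\<close>. Hence the sum of \<open>f\<close> over a full period is twice this sum plus \<open>f 0 + f r\<close>
(\<open>sum_even_periodic\<close>); the terms \<open>f 0\<close> and \<open>f r\<close> are the two corrections at the end of
the formula.

The sum over a full period is, for each weight, a quadratic Gauss sum of modulus \<open>2 r\<close>, and
reciprocity (\<open>quadratic_gauss_sum_reciprocity\<close>) turns it into one with \<open>\<bar>b\<bar>\<close> terms. The reciprocity law
is proved with the kernel \<open>1 / (exp (2 \<pi> \<i> z) - 1)\<close>, which has period 1 and residue
\<open>1 / (2 \<pi> \<i>)\<close> at the integers. For \<open>Q z = exp (\<pi> \<i> (A z\<^sup>2 + B z) / c)\<close> the residue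
theorem, applied to parallelograms around an integer \<open>n\<close> whose long sides have direction \<open>1 + \<i>\<close>,
gives \<open>Q n\<close> as an integral of \<open>(Q (z + n + 1) - Q (z + n)) / (exp (2 \<pi> \<i> z) - 1)\<close> along one
infinite diagonal line, because \<open>Q\<close> decays like a Gaussian in this direction. Summed over
\<open>n < c\<close>, the numerators telescope to \<open>Q (z + c) - Q z = Q z (exp (2 \<pi> \<i> A z) - 1)\<close>; the quotient is
a geometric sum of \<open>A\<close> entire functions, and the integral of each of them is a Gaussian integral.
\<close>

section \<open>A Gaussian integral\<close>

text \<open>
The real part of \<open>p\<close> is removed by completing the square, that is, by a translation and a rescaling of
the variable; what its imaginary part leaves is the characteristic function of the standard normal
distribution.
\<close>

lemma gaussian_integral_linear_exponent:
  fixes a :: real and p :: complex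
  assumes "a > 0"
  shows "has_bochner_integral lborel (\<lambda>s. exp (- of_real a * (of_real s)\<^sup>2 + p * of_real s))
           (of_real (sqrt (pi / a)) * exp (p\<^sup>2 / (4 * of_real a)))"
proof -
  \<comment> \<open>Substituting \<open>s = u/(2a) + c x\<close> turns \<open>- a s\<^sup>2 + u s\<close> into \<open>u\<^sup>2/(4a) - x\<^sup>2/2\<close>.\<close>
  define u v where "u = Re p" and "v = Im p"
  have p: "p = of_real u + \<i> * of_real v" by (simp add: u_def v_def complex_eq)
  define c where "c = 1 / sqrt (2 * a)"
  have c: "c > 0" "c\<^sup>2 = 1 / (2 * a)" using assms by (simp_all add: c_def power_divide)
  interpret real_distribution std_normal_distribution by (rule real_dist_normal_dist)
  have "integrable std_normal_distribution (\<lambda>x. iexp (v * c * x))"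
    by (rule integrable_iexp) auto
  then have "integrable lborel (\<lambda>x. std_normal_density x *\<^sub>R iexp (v * c * x))"
    by (subst (asm) integrable_density) auto
  moreover have "(LBINT x. std_normal_density x *\<^sub>R iexp (v * c * x)) = exp (- of_real ((v * c)\<^sup>2 / 2))"
    using fun_cong[OF char_std_normal_distribution, of "v * c"]
    by (simp add: char_def integral_density exp_of_real[symmetric])
  ultimately have "has_bochner_integral lborel (\<lambda>x. std_normal_density x *\<^sub>R iexp (v * c * x))
      (exp (- of_real ((v * c)\<^sup>2 / 2)))"
    by (simp add: has_bochner_integral_iff)
  from has_bochner_integral_mult_right[OF this, of "of_real (c * sqrt (2*pi)) * exp (p * of_real (u/(2*a)) - a * (of_real (u/(2*a)))\<^sup>2)"]
  have 1: "has_bochner_integral lborel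
          (\<lambda>x. of_real (c * sqrt (2*pi)) * exp (p * of_real (u/(2*a)) - a * (of_real (u/(2*a)))\<^sup>2) *
             (std_normal_density x *\<^sub>R iexp (v * c * x)))
          (of_real (c * sqrt (2*pi)) * exp (p * of_real (u/(2*a)) - a * (of_real (u/(2*a)))\<^sup>2) *
            (exp (- of_real ((v * c)\<^sup>2 / 2))))"
    by simp
  have 2: "of_real (c * sqrt (2*pi)) * exp (p * of_real (u/(2*a)) - a * (of_real (u/(2*a)))\<^sup>2) *
             (std_normal_density x *\<^sub>R iexp (v * c * x)) =
           c *\<^sub>R exp (- of_real a * (of_real (u/(2*a) + c * x))\<^sup>2 + p * of_real (u/(2*a) + c * x))" for x :: real
  proof -
    have e: "- (x\<^sup>2 / 2) = - a * (c * x)\<^sup>2"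
      using c assms by (simp add: power_mult_distrib)
    have "of_real (c * sqrt (2*pi)) * exp (p * of_real (u/(2*a)) - a * (of_real (u/(2*a)))\<^sup>2) *
             (std_normal_density x *\<^sub>R iexp (v * c * x)) = 
        of_real c * (exp (p * of_real (u/(2*a)) - a * (of_real (u/(2*a)))\<^sup>2) * exp (of_real (- a * (c * x)\<^sup>2)) * iexp (v * c * x))"
      by (simp add: std_normal_density_def scaleR_conv_of_real e exp_of_real[symmetric])
    also have "exp (p * of_real (u/(2*a)) - a * (of_real (u/(2*a)))\<^sup>2) * exp (of_real (- a * (c * x)\<^sup>2)) * iexp (v * c * x)
       = exp (p * of_real (u/(2*a)) - a * (of_real (u/(2*a)))\<^sup>2 + of_real (- a * (c * x)\<^sup>2) + \<i> * of_real (v * c * x))"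
      by (simp only: exp_add)
    also have "p * of_real (u/(2*a)) - a * (of_real (u/(2*a)))\<^sup>2 + of_real (- a * (c * x)\<^sup>2) + \<i> * of_real (v * c * x)
        = - of_real a * (of_real (u/(2*a) + c * x))\<^sup>2 + p * of_real (u/(2*a) + c * x)"
      using assms by (simp add: p field_simps power2_eq_square)
    finally show ?thesis by (simp add: scaleR_conv_of_real)
  qed
  have 3: "of_real (c * sqrt (2*pi)) * exp (p * of_real (u/(2*a)) - a * (of_real (u/(2*a)))\<^sup>2) * (exp (- of_real ((v * c)\<^sup>2 / 2)))
       = of_real (sqrt (pi / a)) * exp (p\<^sup>2 / (4 * of_real a))"
  proof -
    have "c * sqrt (2*pi) = sqrt (pi / a)"
      using assms by (simp add: c_def real_sqrt_mult real_sqrt_divide)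
    moreover have "p * of_real (u/(2*a)) - a * (of_real (u/(2*a)))\<^sup>2 + (- of_real ((v * c)\<^sup>2 / 2)) = p\<^sup>2 / (4 * of_real a)"
      using assms by (simp add: p c power_mult_distrib) (simp add: field_simps power2_eq_square)
    ultimately show ?thesis by (metis exp_add mult.assoc)
  qed
  have "has_bochner_integral lborel (\<lambda>x. exp (- of_real a * (of_real (u/(2*a) + c * x))\<^sup>2 + p * of_real (u/(2*a) + c * x)))
     ((of_real (sqrt (pi / a)) * exp (p\<^sup>2 / (4 * of_real a))) /\<^sub>R c)"
    using has_bochner_integral_scaleR_right[OF 1[unfolded 2 3], of "1/c"] c by (simp add: divideR_right inverse_eq_divide)
  then show ?thesis
    using lborel_has_bochner_integral_real_affine_iff[of c "\<lambda>s. exp (- of_real a * (of_real s)\<^sup>2 + p * of_real s)"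
       "of_real (sqrt (pi / a)) * exp (p\<^sup>2 / (4 * of_real a))" "u/(2*a)"] c
    by simp
qed

section \<open>Integrals along a diagonal line\<close>

text \<open>
The origin is to the left of each of the four sides, so each of them contributes a winding number
whose real part lies in \<open>(0, 1/2)\<close>; the sum is an integer, hence 1.
\<close>

lemma winding_number_parallelogram:
  fixes T :: real
  assumes "T > 0"
  defines "d \<equiv> of_real T * (1 + \<i>)"
  defines "g \<equiv> linepath (-1/2 - d) (1/2 - d) +++ linepath (1/2 - d) (1/2 + d) +++
           linepath (1/2 + d) (-1/2 + d) +++ linepath (-1/2 + d) (-1/2 - d)"
  shows "winding_number g 0 = 1" and "0 \<notin> path_image g"
proof -
  \<comment> \<open>If the origin lies strictly to the left of the line through \<open>x\<close> and \<open>y\<close>, it is off the segment.\<close>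
  have left: "0 \<notin> closed_segment x y" if "Im ((y - x) * cnj y) > 0" for x y :: complex
  proof
    assume "0 \<in> closed_segment x y"
    then obtain t where t: "0 = (1 - t) *\<^sub>R x + t *\<^sub>R y" by (auto simp: in_segment)
    then have "y = (1 - t) *\<^sub>R (y - x)" by (simp add: algebra_simps)
    then have "(y - x) * cnj y = of_real ((1 - t) * norm (y - x) ^ 2)"
      by (metis complex_cnj_scaleR complex_norm_square mult_scaleR_right of_real_mult scaleR_conv_of_real)
    with that show False by (metis Im_complex_of_real less_irrefl)
  qed
  have s: "Im (((1/2 - d) - (-1/2 - d)) * cnj (1/2 - d)) > 0" "Im (((1/2 + d) - (1/2 - d)) * cnj (1/2 + d)) > 0"
       "Im (((-1/2 + d) - (1/2 + d)) * cnj (-1/2 + d)) > 0" "Im (((-1/2 - d) - (-1/2 + d)) * cnj (-1/2 - d)) > 0"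
    using assms by (auto simp: field_simps)
  note n = s[THEN left]
  show n0: "0 \<notin> path_image g"
    using n by (auto simp: g_def path_image_join)
  have pos: "Re (winding_number (linepath x y) 0) > 0" if "Im ((y - x) * cnj y) > 0" for x y :: complex
    using winding_number_linepath_pos_lt[of y x 0] that by simp
  have "winding_number g 0 = winding_number (linepath (-1/2 - d) (1/2 - d)) 0 +
     (winding_number (linepath (1/2 - d) (1/2 + d)) 0 + (winding_number (linepath (1/2 + d) (-1/2 + d)) 0
     + winding_number (linepath (-1/2 + d) (-1/2 - d)) 0))"
    using n by (simp add: g_def winding_number_join path_image_join)
  \<comment> \<open>Each side turns by less than half a revolution, in the positive direction, so the total lies
     strictly between 0 and 2.\<close>
  moreover have "winding_number g 0 \<in> \<int>"
    by (rule integer_winding_number[OF _ _ n0]) (auto simp: g_def)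
  then obtain k where "winding_number g 0 = of_int k" by (auto elim: Ints_cases)
  moreover note s[THEN pos] n[THEN winding_number_lt_half_linepath]
  ultimately have "0 < real_of_int k" "real_of_int k < 2"
    by (smt (verit) Re_complex_of_real of_real_of_int_eq plus_complex.simps(1) field_sum_of_halves)+
  then have "k = 1" by linarith
  then show "winding_number g 0 = 1" using \<open>winding_number g 0 = of_int k\<close> by simp
qed

definition diag :: "real \<Rightarrow> complex" where
  "diag s = of_real s * (1 + \<i>)"

lemma exp_2pi_eq_1_iff: "exp (2 * of_real pi * \<i> * z) = 1 \<longleftrightarrow> z \<in> \<int>" for z :: complex
proof
  assume "exp (2 * of_real pi * \<i> * z) = 1"
  then obtain n :: int where "Im z = 0" "Re z = of_int n" by (auto simp: exp_eq_1)
  then have "z = of_int n" by (simp add: complex_eq_iff)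
  then show "z \<in> \<int>" by simp
next
  assume "z \<in> \<int>"
  then show "exp (2 * of_real pi * \<i> * z) = 1" by (auto elim!: Ints_cases simp: exp_eq_1)
qed

text \<open>
The case \<open>Q 0 = 0\<close>, in which the singularity is removable, is included: the residue is computed as
the limit of \<open>z\<close> times the function.
\<close>

lemma residue_quotient_exp_2pi:
  assumes "Q holomorphic_on UNIV"
  shows "residue (\<lambda>z. Q z / (exp (2 * of_real pi * \<i> * z) - 1)) 0 = Q 0 / (2 * of_real pi * \<i>)"
proof (rule residue_simple'[where s = "ball 0 1"])
  have ne: "exp (2 * of_real pi * \<i> * z) \<noteq> 1" if "z \<in> ball 0 1 - {0}" for z
  proof
    assume "exp (2 * of_real pi * \<i> * z) = 1"
    then obtain n where "z = of_int n" by (auto simp: exp_2pi_eq_1_iff elim: Ints_cases)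
    with that show False by auto
  qed
  then show "(\<lambda>z. Q z / (exp (2 * of_real pi * \<i> * z) - 1)) holomorphic_on ball 0 1 - {0}"
    by (intro holomorphic_intros holomorphic_on_subset[OF assms]) auto
  have "((\<lambda>z. exp (2 * of_real pi * \<i> * z)) has_field_derivative 2 * of_real pi * \<i>) (at 0)"
    by (auto intro!: derivative_eq_intros)
  then have "((\<lambda>z. (exp (2 * of_real pi * \<i> * z) - 1) / z) \<longlongrightarrow> 2 * of_real pi * \<i>) (at 0)"
    by (simp add: has_field_derivative_iff)
  moreover have "(Q \<longlongrightarrow> Q 0) (at 0)"
    using holomorphic_on_imp_continuous_on[OF assms] by (simp add: continuous_on_def)
  ultimately have "((\<lambda>z. Q z / ((exp (2 * of_real pi * \<i> * z) - 1) / z)) \<longlongrightarrow> Q 0 / (2 * of_real pi * \<i>)) (at 0)"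
    by (intro tendsto_divide) auto
  then show "((\<lambda>z. Q z / (exp (2 * of_real pi * \<i> * z) - 1) * (z - 0)) \<longlongrightarrow> Q 0 / (2 * of_real pi * \<i>)) (at 0)"
    by simp
qed auto

text \<open>
The residue theorem for the parallelogram with corners \<open>\<plusminus>1/2 \<plusminus> diag T\<close>, with the two diagonal
sides, which differ by a translation by 1, combined into one integral.
\<close>

lemma contour_integral_parallelogram:
  fixes T :: real and Q :: "complex \<Rightarrow> complex"
  assumes Q: "Q holomorphic_on UNIV" and "T > 0"
  defines "F \<equiv> \<lambda>z. Q z / (exp (2 * of_real pi * \<i> * z) - 1)"
  shows "contour_integral (linepath (-1/2 - diag T) (-1/2 + diag T)) (\<lambda>z. (Q (z + 1) - Q z) / (exp (2 * of_real pi * \<i> * z) - 1))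
       + contour_integral (linepath (-1/2 - diag T) (1/2 - diag T)) F
       - contour_integral (linepath (-1/2 + diag T) (1/2 + diag T)) F = Q 0"
proof -
  define d where "d = diag T"
  let ?g = "linepath (-1/2 - d) (1/2 - d) +++ linepath (1/2 - d) (1/2 + d) +++
           linepath (1/2 + d) (-1/2 + d) +++ linepath (-1/2 + d) (-1/2 - d)"
  note wn = winding_number_parallelogram[OF \<open>T > 0\<close>, folded diag_def d_def]
  \<comment> \<open>The open strip around the parallelogram that contains no integer except 0.\<close>
  define S where "S = {z. Re z - Im z < 1} \<inter> {z. Re z - Im z > -1}"
  have S: "open S" "convex S"
  proof -
    have *: "Re z - Im z = inner (1 - \<i>) z" for z by (simp add: inner_complex_def)
    show "open S" "convex S" unfolding S_def *
      by (intro open_Int open_halfspace_lt open_halfspace_gt convex_Int convex_halfspace_lt convex_halfspace_gt)+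
  qed
  have corners: "-1/2 - d \<in> S" "1/2 - d \<in> S" "1/2 + d \<in> S" "-1/2 + d \<in> S"
    by (auto simp: S_def d_def diag_def)
  have segs: "closed_segment x y \<subseteq> S" if "x \<in> S" "y \<in> S" for x y
    using that S(2) by (simp add: closed_segment_subset)
  have img: "path_image ?g \<subseteq> S - {0}"
    using wn(2) corners segs by (auto simp: path_image_join dest!: subsetD)
  have S0: "exp (2 * of_real pi * \<i> * z) \<noteq> 1" if "z \<in> S - {0}" for z
    using that by (auto simp: exp_2pi_eq_1_iff S_def elim!: Ints_cases)
  have hol: "F holomorphic_on S - {0}"
    unfolding F_def by (intro holomorphic_intros holomorphic_on_subset[OF Q]) (use S0 in auto)
  have "contour_integral ?g F = 2 * pi * \<i> * (\<Sum>p\<in>{0}. winding_number ?g p * residue F p)"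
  proof (rule Residue_theorem[OF S(1) convex_connected[OF S(2)] _ hol _ _ img])
    show "\<forall>z. z \<notin> S \<longrightarrow> winding_number ?g z = 0"
      using img S(2) by (intro allI impI winding_number_zero_outside[where s=S]) (auto simp del: path_image_join)
  qed auto
  also have "\<dots> = Q 0"
    by (simp add: wn(1)[simplified] F_def residue_quotient_exp_2pi[OF Q])
  finally have total: "contour_integral ?g F = Q 0" .
  have cont: "continuous_on (closed_segment x y) F" if "closed_segment x y \<subseteq> S - {0}" for x y
    using hol that holomorphic_on_imp_continuous_on continuous_on_subset by blast
  have sub: "closed_segment (-1/2 - d) (1/2 - d) \<subseteq> S - {0}" "closed_segment (1/2 - d) (1/2 + d) \<subseteq> S - {0}"
     "closed_segment (1/2 + d) (-1/2 + d) \<subseteq> S - {0}" "closed_segment (-1/2 + d) (-1/2 - d) \<subseteq> S - {0}"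
    using img by (auto simp: path_image_join)
  note int = sub[THEN cont, THEN contour_integrable_continuous_linepath]
  have "contour_integral ?g F = contour_integral (linepath (-1/2 - d) (1/2 - d)) F +
     (contour_integral (linepath (1/2 - d) (1/2 + d)) F + (contour_integral (linepath (1/2 + d) (-1/2 + d)) F
     + contour_integral (linepath (-1/2 + d) (-1/2 - d)) F))"
    using int by (simp add: contour_integral_join contour_integrable_joinI)
  also have "contour_integral (linepath (1/2 + d) (-1/2 + d)) F = - contour_integral (linepath (-1/2 + d) (1/2 + d)) F"
    using contour_integral_reverse_linepath[OF cont, of "-1/2 + d" "1/2+d"] sub(3) by (simp add: closed_segment_commute)
  also have "contour_integral (linepath (-1/2 + d) (-1/2 - d)) F = - contour_integral (linepath (-1/2 - d) (-1/2 + d)) F"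
    using contour_integral_reverse_linepath[OF cont, of "-1/2 - d" "-1/2+d"] sub(4) by (simp add: closed_segment_commute)
  \<comment> \<open>The right side is the left side moved by 1, and the kernel has period 1.\<close>
  also have "contour_integral (linepath (1/2 - d) (1/2 + d)) F = contour_integral (linepath (-1/2 - d) (-1/2 + d)) (\<lambda>z. F (z + 1))"
  proof -
    have "linepath (1/2 - d) (1/2 + d) x = linepath (-1/2 - d) (-1/2 + d) x + 1" for x
      by (simp add: linepath_def algebra_simps scaleR_conv_of_real)
    then show ?thesis
      unfolding contour_integral_integral by (intro integral_cong) simp
  qed
  finally have "contour_integral (linepath (-1/2 - d) (-1/2 + d)) (\<lambda>z. F (z + 1)) - contour_integral (linepath (-1/2 - d) (-1/2 + d)) F
      + contour_integral (linepath (-1/2 - d) (1/2 - d)) F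
       - contour_integral (linepath (-1/2 + d) (1/2 + d)) F = Q 0"
    unfolding total by (simp add: algebra_simps)
  also have "contour_integral (linepath (-1/2 - d) (-1/2 + d)) (\<lambda>z. F (z + 1)) - contour_integral (linepath (-1/2 - d) (-1/2 + d)) F
     = contour_integral (linepath (-1/2 - d) (-1/2 + d)) (\<lambda>z. F (z + 1) - F z)"
  proof (rule contour_integral_diff[symmetric])
    show "F contour_integrable_on linepath (-1/2 - d) (-1/2 + d)"
      using int(4) contour_integrable_reversepath[of "linepath (-1/2 + d) (-1/2 - d)"] by auto
    have "continuous_on (closed_segment (-1/2 - d) (-1/2 + d)) (\<lambda>z. F (z + 1))"
    proof (rule continuous_on_compose2[OF cont[OF sub(2)]])
      have "(+) 1 ` closed_segment (-1/2 - d) (-1/2 + d) = closed_segment (1 + (-1/2 - d)) (1 + (-1/2 + d))"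
        by (rule closed_segment_translation[symmetric])
      moreover have "1 + (-1/2 - d) = 1/2 - d" "1 + (-1/2 + d) = 1/2 + d" by (simp_all add: field_simps)
      ultimately have "(\<lambda>z. z + 1) ` closed_segment (-1/2 - d) (-1/2 + d) = closed_segment (1/2 - d) (1/2 + d)" 
        by (simp only: add.commute[of _ 1])
      then show "(\<lambda>z. z + 1) ` closed_segment (-1/2 - d) (-1/2 + d) \<subseteq> closed_segment (1/2 - d) (1/2 + d)" by simp
    qed (intro continuous_intros)
    then show "(\<lambda>z. F (z + 1)) contour_integrable_on linepath (-1/2 - d) (-1/2 + d)"
      by (rule contour_integrable_continuous_linepath)
  qed
  also have "(\<lambda>z. F (z + 1) - F z) = (\<lambda>z. (Q (z + 1) - Q z) / (exp (2 * of_real pi * \<i> * z) - 1))"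
    by (simp add: F_def diff_divide_distrib distrib_left exp_add)
  finally show ?thesis unfolding d_def .
qed

lemma contour_integral_linepath_diag:
  assumes "T > 0" "continuous_on UNIV f"
  shows "contour_integral (linepath (-1/2 - diag T) (-1/2 + diag T)) f
    = (1 + \<i>) * (LBINT s:{-T..T}. f (-1/2 + diag s))"
proof -
  let ?g = "\<lambda>s. f (-1/2 + diag s)"
  have cont: "continuous_on {-T..T} ?g"
    by (rule continuous_on_compose2[OF assms(2)]) (auto simp: diag_def intro!: continuous_intros)
  have "(?g has_integral (LBINT s:{-T..T}. ?g s)) (cbox (-T) T)"
    using has_integral_set_lebesgue[of "{-T..T}" ?g] borel_integrable_atLeastAtMost'[OF cont] 
    by (simp add: set_borel_integral_eq_integral integrable_integral)
  have img: "(\<lambda>x. x / (2 * T) + 1 / 2) ` {-T..T} = {0..1}"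
    using image_affinity_atLeastAtMost_div[of "2 * T" "1 / 2" "-T" T] \<open>T > 0\<close> by simp
  from has_integral_affinity[OF \<open>(?g has_integral _) _\<close>, of "2 * T" "-T"]
  have "((\<lambda>x. ?g (2 * T * x - T)) has_integral ((1 / (2 * T)) *\<^sub>R (LBINT s:{-T..T}. ?g s))) {0..1}"
    using \<open>T > 0\<close> by (simp add: img)
  from has_integral_mult_right[OF this, of "2 * diag T"]
  have "((\<lambda>x. f (linepath (-1/2 - diag T) (-1/2 + diag T) x) * (-1/2 + diag T - (-1/2 - diag T))) has_integral
        ((1 + \<i>) * (LBINT s:{-T..T}. ?g s))) {0..1}"
  proof (rule has_integral_eq_rhs[OF has_integral_eq, rotated])
    show "(1 + \<i>) * (LBINT s:{-T..T}. ?g s) = 2 * diag T * ((1 / (2 * T)) *\<^sub>R (LBINT s:{-T..T}. ?g s))"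
      using \<open>T > 0\<close> by (simp add: diag_def scaleR_conv_of_real field_simps)
    fix x :: real
    have "linepath (-1/2 - diag T) (-1/2 + diag T) x = -1/2 + diag (2 * T * x - T)"
      by (simp add: linepath_def diag_def scaleR_conv_of_real field_simps)
    then show "2 * diag T * ?g (2 * T * x - T) = f (linepath (-1/2 - diag T) (-1/2 + diag T) x) * (-1/2 + diag T - (-1/2 - diag T))"
      by simp
  qed
  then show ?thesis
    by (intro contour_integral_unique) (simp add: has_contour_integral_linepath)
qed


section \<open>Exponentials of quadratic polynomials\<close>

text \<open>
The general polynomial is carried along, with complex lower coefficients, because this class of
functions is closed under translation (\<open>quad_exp_shift\<close>).
\<close>

definition quad_exp :: "real \<Rightarrow> complex \<Rightarrow> complex \<Rightarrow> complex \<Rightarrow> complex" where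
  "quad_exp \<alpha> \<beta> \<gamma> z = exp (\<i> * (of_real \<alpha> * z\<^sup>2 + \<beta> * z + \<gamma>))"

lemma quad_exp_shift:
  "quad_exp \<alpha> \<beta> \<gamma> (z + w) = quad_exp \<alpha> (\<beta> + 2 * of_real \<alpha> * w) (\<gamma> + \<beta> * w + of_real \<alpha> * w\<^sup>2) z"
  by (simp add: quad_exp_def power2_eq_square algebra_simps)

text \<open>
In the direction \<open>1 + \<i>\<close> the imaginary part of \<open>z\<^sup>2\<close> grows like \<open>2 s\<^sup>2\<close>, which makes the
numerator decay. The modulus of \<open>exp (2 \<pi> \<i> z)\<close> is \<open>exp (- 2 \<pi> s)\<close>, which is at most 1/2 or
at least 2 when \<open>\<bar>s\<bar> \<ge> 1\<close>; hence the factor 2.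
\<close>

lemma norm_quad_exp_quotient_le:
  fixes s x :: real
  assumes "\<alpha> > 0" "\<bar>x\<bar> \<le> 1/2" "\<bar>s\<bar> \<ge> 1"
  shows "norm (quad_exp \<alpha> \<beta> \<gamma> (of_real x + diag s) / (exp (2 * of_real pi * \<i> * (of_real x + diag s)) - 1))
       \<le> 2 * exp (- 2 * \<alpha> * s\<^sup>2 + (\<alpha> + 2 * norm \<beta>) * \<bar>s\<bar> + norm \<beta> + norm \<gamma>)"
proof -
  let ?z = "of_real x + diag s"
  have "norm (exp (2 * of_real pi * \<i> * ?z) - 1) \<ge> \<bar>norm (exp (2 * of_real pi * \<i> * ?z)) - 1\<bar>"
    using norm_triangle_ineq3[of "exp (2 * of_real pi * \<i> * ?z)" 1] by simp
  also have "norm (exp (2 * of_real pi * \<i> * ?z)) = exp (- (2 * pi * s))"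
    by (simp add: diag_def)
  finally have den0: "norm (exp (2 * of_real pi * \<i> * ?z) - 1) \<ge> \<bar>exp (- (2 * pi * s)) - 1\<bar>" .
  have "\<bar>exp (- (2 * pi * s)) - 1\<bar> \<ge> 1 / 2"
  proof (cases "s \<ge> 0")
    case True
    have "2 * pi * s \<ge> 1" using True assms(3) pi_gt3 mult_mono[of 1 pi 1 s] by auto
    then have "exp (2 * pi * s) \<ge> 2" using exp_ge_add_one_self[of "2 * pi * s"] by linarith
    then have "exp (- (2 * pi * s)) \<le> 1 / 2" by (simp add: exp_minus field_simps)
    then show ?thesis by linarith
  next
    case False
    have "2 * pi * (-s) \<ge> 1" using False assms(3) pi_gt3 mult_mono[of 1 pi 1 "-s"] by auto
    then show ?thesis using exp_ge_add_one_self[of "2 * pi * (-s)"] by simp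
  qed
  with den0 have den: "norm (exp (2 * of_real pi * \<i> * ?z) - 1) \<ge> 1 / 2" by linarith
  have "norm ?z \<le> \<bar>x\<bar> + \<bar>s\<bar> * 2"
  proof -
    have "norm (1 + \<i>) \<le> 2" using norm_triangle_ineq[of 1 \<i>] by simp
    then have "norm (diag s) \<le> \<bar>s\<bar> * 2" by (simp add: diag_def norm_mult mult_left_mono)
    then show ?thesis using norm_triangle_ineq[of "of_real x" "diag s"] by simp
  qed
  then have "norm \<beta> * norm ?z \<le> norm \<beta> * (1 + 2 * \<bar>s\<bar>)"
    using assms by (intro mult_left_mono) auto
  moreover have "- Im (\<beta> * ?z) \<le> norm \<beta> * norm ?z"
    by (metis abs_Im_le_cmod abs_le_D2 norm_mult)
  moreover have "- Im \<gamma> \<le> norm \<gamma>" by (metis abs_Im_le_cmod abs_le_D2)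
  moreover have "- (\<alpha> * Im (?z\<^sup>2)) \<le> - 2 * \<alpha> * s\<^sup>2 + \<alpha> * \<bar>s\<bar>"
  proof -
    have "\<bar>2 * x\<bar> * \<bar>s\<bar> \<le> 1 * \<bar>s\<bar>" using assms by (intro mult_right_mono) auto
    then have "- (2 * x * s) \<le> \<bar>s\<bar>" by (simp add: abs_mult[symmetric])
    then have "\<alpha> * (- (2 * x * s)) \<le> \<alpha> * \<bar>s\<bar>" using assms by (intro mult_left_mono) auto
    then show ?thesis by (simp add: diag_def power2_eq_square algebra_simps)
  qed
  ultimately have "Re (\<i> * (of_real \<alpha> * ?z\<^sup>2 + \<beta> * ?z + \<gamma>)) \<le> - 2 * \<alpha> * s\<^sup>2 + (\<alpha> + 2 * norm \<beta>) * \<bar>s\<bar> + norm \<beta> + norm \<gamma>"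
    by (simp add: algebra_simps)
  then have num: "norm (quad_exp \<alpha> \<beta> \<gamma> ?z) \<le> exp (- 2 * \<alpha> * s\<^sup>2 + (\<alpha> + 2 * norm \<beta>) * \<bar>s\<bar> + norm \<beta> + norm \<gamma>)"
    unfolding quad_exp_def norm_exp_eq_Re by simp
  have "norm (quad_exp \<alpha> \<beta> \<gamma> ?z) / norm (exp (2 * of_real pi * \<i> * ?z) - 1) \<le> 
       exp (- 2 * \<alpha> * s\<^sup>2 + (\<alpha> + 2 * norm \<beta>) * \<bar>s\<bar> + norm \<beta> + norm \<gamma>) / (1/2)"
    by (rule frac_le[OF _ num _ den]) auto
  then show ?thesis by (simp add: norm_divide mult.commute)
qed

lemma contour_integral_quad_exp_horizontal_tendsto_0:
  assumes "\<alpha> > 0" "\<sigma> \<in> {-1, 1 :: real}"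
  shows "((\<lambda>T. contour_integral (linepath (-1/2 + diag (\<sigma> * T)) (1/2 + diag (\<sigma> * T)))
            (\<lambda>z. quad_exp \<alpha> \<beta> \<gamma> z / (exp (2 * of_real pi * \<i> * z) - 1))) \<longlongrightarrow> 0) at_top"
proof (rule Lim_null_comparison)
  define p q where "p = \<alpha> + 2 * norm \<beta>" and "q = norm \<beta> + norm \<gamma>"
  show "((\<lambda>T. 2 * exp (- 2 * \<alpha> * T\<^sup>2 + p * T + q)) \<longlongrightarrow> 0) at_top"
    using assms(1) by real_asymp
  show "\<forall>\<^sub>F T in at_top. norm (contour_integral (linepath (-1/2 + diag (\<sigma> * T)) (1/2 + diag (\<sigma> * T)))
            (\<lambda>z. quad_exp \<alpha> \<beta> \<gamma> z / (exp (2 * of_real pi * \<i> * z) - 1))) \<le> 2 * exp (- 2 * \<alpha> * T\<^sup>2 + p * T + q)"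
    using eventually_ge_at_top[of 1]
  proof eventually_elim
    case (elim T)
    let ?d = "diag (\<sigma> * T)" and ?F = "\<lambda>z. quad_exp \<alpha> \<beta> \<gamma> z / (exp (2 * of_real pi * \<i> * z) - 1)"
    have abs: "\<bar>\<sigma> * T\<bar> = T" "(\<sigma> * T)\<^sup>2 = T\<^sup>2" using assms(2) elim by auto
    have pt: "\<exists>x. \<bar>x\<bar> \<le> 1/2 \<and> z = of_real x + ?d" if "z \<in> closed_segment (-1/2 + ?d) (1/2 + ?d)" for z
    proof -
      from that obtain t where t: "0 \<le> t" "t \<le> 1" "z = (1 - t) *\<^sub>R (-1/2 + ?d) + t *\<^sub>R (1/2 + ?d)"
        by (auto simp: in_segment)
      have "(1 - t) *\<^sub>R (-1/2 + ?d) + t *\<^sub>R (1/2 + ?d) = of_real (t - 1/2) + ?d"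
        by (simp add: complex_eq_iff algebra_simps)
      then have "z = of_real (t - 1/2) + ?d" using t by simp
      moreover have "\<bar>t - 1/2\<bar> \<le> 1/2" using t(1,2) by linarith
      ultimately show ?thesis by blast
    qed
    have bnd: "norm (?F z) \<le> 2 * exp (- 2 * \<alpha> * T\<^sup>2 + p * T + q)"
      if z: "z \<in> closed_segment (-1/2 + ?d) (1/2 + ?d)" for z
    proof -
      obtain x where x: "\<bar>x\<bar> \<le> 1/2" "z = of_real x + ?d" using pt[OF z] by blast
      show ?thesis using norm_quad_exp_quotient_le[OF assms(1) x(1), of "\<sigma> * T" \<beta> \<gamma>] elim
        unfolding x(2) abs p_def q_def by (simp only: add.assoc)
    qed
    have "exp (2 * of_real pi * \<i> * z) \<noteq> 1" if z: "z \<in> closed_segment (-1/2 + ?d) (1/2 + ?d)" for z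
    proof
      assume "exp (2 * of_real pi * \<i> * z) = 1"
      then have "Im z = 0" by (auto simp: exp_2pi_eq_1_iff elim: Ints_cases)
      with pt[OF z] abs elim show False by (auto simp: diag_def)
    qed
    then have "?F contour_integrable_on linepath (-1/2 + ?d) (1/2 + ?d)"
      by (intro contour_integrable_continuous_linepath continuous_intros) (auto simp: quad_exp_def intro!: continuous_intros)
    from contour_integral_bound_linepath[OF this _ bnd]
    have "norm (contour_integral (linepath (-1/2 + ?d) (1/2 + ?d)) ?F) \<le>
       2 * exp (- 2 * \<alpha> * T\<^sup>2 + p * T + q) * norm (1/2 + ?d - (-1/2 + ?d))" by simp
    then show ?case by simp
  qed
qed
text \<open>
The value at 0 is a limit of diagonal integrals, because the horizontal sides of the parallelogram
contribute nothing in the limit.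
\<close>

lemma quad_exp_difference_quotient_tendsto:
  assumes "\<alpha> > 0"
  shows "((\<lambda>T. contour_integral (linepath (-1/2 - diag T) (-1/2 + diag T))
            (\<lambda>z. (quad_exp \<alpha> \<beta> \<gamma> (z + 1) - quad_exp \<alpha> \<beta> \<gamma> z) / (exp (2 * of_real pi * \<i> * z) - 1)))
          \<longlongrightarrow> quad_exp \<alpha> \<beta> \<gamma> 0) at_top"
proof -
  let ?F = "\<lambda>z. quad_exp \<alpha> \<beta> \<gamma> z / (exp (2 * of_real pi * \<i> * z) - 1)"
  have "((\<lambda>T. quad_exp \<alpha> \<beta> \<gamma> 0
        - contour_integral (linepath (-1/2 + diag (-1 * T)) (1/2 + diag (-1 * T))) ?F
        + contour_integral (linepath (-1/2 + diag (1 * T)) (1/2 + diag (1 * T))) ?F) \<longlongrightarrow> quad_exp \<alpha> \<beta> \<gamma> 0 - 0 + 0) at_top"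
    by (intro tendsto_intros contour_integral_quad_exp_horizontal_tendsto_0 assms) auto
  then have lim: "((\<lambda>T. quad_exp \<alpha> \<beta> \<gamma> 0
        - contour_integral (linepath (-1/2 - diag T) (1/2 - diag T)) ?F
        + contour_integral (linepath (-1/2 + diag T) (1/2 + diag T)) ?F) \<longlongrightarrow> quad_exp \<alpha> \<beta> \<gamma> 0) at_top"
    by (simp add: diag_def)
  have hol: "quad_exp \<alpha> \<beta> \<gamma> holomorphic_on UNIV"
    unfolding quad_exp_def by (intro holomorphic_intros)
  show ?thesis
  proof (rule Lim_transform_eventually[OF lim], use eventually_gt_at_top[of 0] in eventually_elim)
    case (elim T)
    then show ?case using contour_integral_parallelogram[OF hol elim] by (simp add: algebra_simps)
  qed
qed

lemma contour_integral_quad_exp_tendsto: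
  assumes "\<alpha> > 0"
  shows "((\<lambda>T. contour_integral (linepath (-1/2 - diag T) (-1/2 + diag T)) (quad_exp \<alpha> \<beta> \<gamma>))
     \<longlongrightarrow> (1 + \<i>) * of_real (sqrt (pi / (2 * \<alpha>))) * exp (\<i> * \<gamma> - \<i> * \<beta>\<^sup>2 / (4 * of_real \<alpha>))) at_top"
proof -
  define p where "p = (1 + \<i>) * \<i> * (\<beta> - of_real \<alpha>)"
  define q where "q = \<i> * (of_real \<alpha> / 4 - \<beta> / 2 + \<gamma>)"
  let ?g = "\<lambda>s. exp (- of_real (2 * \<alpha>) * (of_real s)\<^sup>2 + p * of_real s)"
  \<comment> \<open>On the line, \<open>(s (1 + \<i>))\<^sup>2 = 2 \<i> s\<^sup>2\<close>, so the oscillating quadratic exponent becomes real and negative.\<close>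
  have eq: "quad_exp \<alpha> \<beta> \<gamma> (-1/2 + diag s) = exp q * ?g s" for s
  proof -
    have "\<i> * (of_real \<alpha> * (-1/2 + diag s)\<^sup>2 + \<beta> * (-1/2 + diag s) + \<gamma>) = q + (- of_real (2 * \<alpha>) * (of_real s)\<^sup>2 + p * of_real s)"
      by (simp add: q_def p_def diag_def power2_eq_square field_simps)
    then show ?thesis by (simp add: quad_exp_def exp_add)
  qed
  have bi: "has_bochner_integral lborel ?g (of_real (sqrt (pi / (2 * \<alpha>))) * exp (p\<^sup>2 / (4 * of_real (2 * \<alpha>))))"
    using gaussian_integral_linear_exponent[of "2 * \<alpha>" p] assms by simp
  have "((\<lambda>T. LBINT s:{-T..T}. ?g s) \<longlongrightarrow> (LBINT s. ?g s)) at_top"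
    unfolding set_lebesgue_integral_def
  proof (rule integral_dominated_convergence_at_top[where w = "\<lambda>s. norm (?g s)"])
    show "integrable lborel (\<lambda>s. norm (?g s))" using bi by (intro integrable_norm) (simp only: has_bochner_integral_iff)
    show "AE s in lborel. ((\<lambda>T. indicator {-T..T} s *\<^sub>R ?g s) \<longlongrightarrow> ?g s) at_top"
    proof (rule AE_I2, rule tendsto_eventually)
      fix s :: real
      show "\<forall>\<^sub>F T in at_top. indicator {-T..T} s *\<^sub>R ?g s = ?g s"
        using eventually_ge_at_top[of "\<bar>s\<bar>"] by eventually_elim (auto simp: indicator_def)
    qed
  qed (auto simp: indicator_def)
  then have lim: "((\<lambda>T. (1 + \<i>) * (exp q * (LBINT s:{-T..T}. ?g s))) \<longlongrightarrow>
      (1 + \<i>) * (exp q * (of_real (sqrt (pi / (2 * \<alpha>))) * exp (p\<^sup>2 / (4 * of_real (2 * \<alpha>)))))) at_top"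
    using bi by (intro tendsto_intros) (simp add: has_bochner_integral_iff)
  have val: "(1 + \<i>) * (exp q * (of_real (sqrt (pi / (2 * \<alpha>))) * exp (p\<^sup>2 / (4 * of_real (2 * \<alpha>)))))
     = (1 + \<i>) * of_real (sqrt (pi / (2 * \<alpha>))) * exp (\<i> * \<gamma> - \<i> * \<beta>\<^sup>2 / (4 * of_real \<alpha>))"
  proof -
    have "((1 + \<i>) * \<i>)\<^sup>2 = -2 * \<i>" by (simp add: complex_eq_iff power2_eq_square)
    then have "p\<^sup>2 = -2 * \<i> * (\<beta> - of_real \<alpha>)\<^sup>2" unfolding p_def power_mult_distrib by simp
    then have "q + p\<^sup>2 / (4 * of_real (2 * \<alpha>)) = \<i> * \<gamma> - \<i> * \<beta>\<^sup>2 / (4 * of_real \<alpha>)"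
      using assms unfolding \<open>p\<^sup>2 = _\<close> q_def by (simp add: power2_eq_square field_simps)
    then show ?thesis by (simp add: exp_add[symmetric] mult_ac)
  qed
  have ev: "\<forall>\<^sub>F T in at_top. (1 + \<i>) * (exp q * (LBINT s:{-T..T}. ?g s)) =
      contour_integral (linepath (-1/2 - diag T) (-1/2 + diag T)) (quad_exp \<alpha> \<beta> \<gamma>)"
    using eventually_gt_at_top[of 0]
  proof eventually_elim
    case (elim T)
    have "continuous_on UNIV (quad_exp \<alpha> \<beta> \<gamma>)"
      unfolding quad_exp_def by (intro continuous_intros)
    then show ?case
      by (simp only: contour_integral_linepath_diag[OF elim] eq set_integral_mult_right)
  qed
  show ?thesis using Lim_transform_eventually[OF lim ev] unfolding val .
qed

section \<open>Reciprocity for quadratic Gauss sums\<close>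

text \<open>
A generalization of the Landsberg-Schaar identity. The phase \<open>exp (\<pi> \<i> / 4)\<close> is the direction of the
line of integration, and the exponents on the right come from completing the square in the Gaussian
integrals.
\<close>

theorem quadratic_gauss_sum_reciprocity:
  fixes A c :: nat and B :: int
  assumes "A > 0" "c > 0" "even (int A * int c + B)"
  shows "(\<Sum>n<c. exp (of_real pi * \<i> * (of_nat A * (of_nat n)\<^sup>2 + of_int B * of_nat n) / of_nat c))
       = of_real (sqrt (c / A)) * exp (of_real pi * \<i> / 4) *
         (\<Sum>m<A. exp (- of_real pi * \<i> * (of_int B + 2 * of_nat m * of_nat c)\<^sup>2 / (4 * of_nat A * of_nat c)))"
proof -
  define \<alpha> :: real where "\<alpha> = pi * A / c"
  define \<beta> :: complex where "\<beta> = of_real pi * of_int B / of_nat c"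
  have \<alpha>: "\<alpha> > 0" using assms by (simp add: \<alpha>_def)
  let ?Q = "quad_exp \<alpha> \<beta> 0"
  let ?e = "\<lambda>z. exp (2 * of_real pi * \<i> * z) :: complex"
  let ?L = "\<lambda>T. linepath (-1/2 - diag T) (-1/2 + diag T)"
  have 1: "((\<lambda>T. \<Sum>n<c. contour_integral (?L T) (\<lambda>z. (?Q (z + 1 + of_nat n) - ?Q (z + of_nat n)) / (?e z - 1)))
         \<longlongrightarrow> (\<Sum>n<c. ?Q (0 + of_nat n))) at_top"
    unfolding quad_exp_shift[of _ _ _ _ "of_nat _"]
    by (intro tendsto_sum quad_exp_difference_quotient_tendsto \<alpha>)
  have 2: "((\<lambda>T. \<Sum>m<A. contour_integral (?L T) (quad_exp \<alpha> (\<beta> + 2 * of_real pi * of_nat m) 0))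
      \<longlongrightarrow> (\<Sum>m<A. (1 + \<i>) * of_real (sqrt (pi / (2 * \<alpha>))) * exp (\<i> * 0 - \<i> * (\<beta> + 2 * of_real pi * of_nat m)\<^sup>2 / (4 * of_real \<alpha>)))) at_top"
    by (intro tendsto_sum contour_integral_quad_exp_tendsto \<alpha>)
  have ne: "?e z \<noteq> 1" if z: "z \<in> closed_segment (-1/2 - diag T) (-1/2 + diag T)" for z T
  proof
    assume "?e z = 1"
    moreover have "Re z - Im z = -1/2"
    proof -
      from z obtain u where u: "z = (1 - u) *\<^sub>R (-1/2 - diag T) + u *\<^sub>R (-1/2 + diag T)"
        by (auto simp: in_segment)
      show ?thesis unfolding u by (simp add: diag_def algebra_simps)
    qed
    ultimately obtain n :: int where "of_int n = (-1/2 :: real)" by (auto simp: exp_2pi_eq_1_iff elim!: Ints_cases)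
    then have "of_int (2 * n) = (of_int (-1) :: real)" by simp
    then have "2 * n = -1" by (simp only: of_int_eq_iff)
    then show False by presburger
  qed
  \<comment> \<open>The parity hypothesis enters here: without it a sign would remain.\<close>
  have per: "?Q (z + of_nat c) = ?Q z * ?e z ^ A" for z
  proof -
    obtain k where k: "int A * int c + B = 2 * k" using assms(3) by (elim evenE)
    have k': "of_nat A * of_nat c + of_int B = (2 * of_int k :: complex)"
      using arg_cong[OF k, of of_int] by simp
    have "\<i> * (of_real \<alpha> * (z + of_nat c)\<^sup>2 + \<beta> * (z + of_nat c)) 
       = \<i> * (of_real \<alpha> * z\<^sup>2 + \<beta> * z) + of_nat A * (2 * of_real pi * \<i> * z) + of_real pi * \<i> * (of_nat A * of_nat c + of_int B)"
      using assms(2) by (simp add: \<alpha>_def \<beta>_def field_simps power2_eq_square)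
    also have "of_real pi * \<i> * (of_nat A * of_nat c + of_int B) = 2 * of_real pi * \<i> * of_int k"
      by (simp add: k')
    finally show ?thesis
      by (simp add: quad_exp_def exp_add exp_of_nat_mult exp_2pi_eq_1_iff)
  qed
  have "(\<Sum>n<c. contour_integral (?L T) (\<lambda>z. (?Q (z + 1 + of_nat n) - ?Q (z + of_nat n)) / (?e z - 1)))
      = (\<Sum>m<A. contour_integral (?L T) (quad_exp \<alpha> (\<beta> + 2 * of_real pi * of_nat m) 0))" for T
  proof -
    have "(\<Sum>n<c. contour_integral (?L T) (\<lambda>z. (?Q (z + 1 + of_nat n) - ?Q (z + of_nat n)) / (?e z - 1)))
       = contour_integral (?L T) (\<lambda>z. \<Sum>n<c. (?Q (z + 1 + of_nat n) - ?Q (z + of_nat n)) / (?e z - 1))"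
      using ne by (intro contour_integral_sum[symmetric] contour_integrable_continuous_linepath)
        (auto simp: quad_exp_def intro!: continuous_intros)
    also have "\<dots> = contour_integral (?L T) (\<lambda>z. \<Sum>m<A. quad_exp \<alpha> (\<beta> + 2 * of_real pi * of_nat m) 0 z)"
    proof (rule contour_integral_cong)
      fix z assume "z \<in> path_image (?L T)"
      then have "?e z \<noteq> 1" using ne by simp
      have "(\<Sum>n<c. (?Q (z + 1 + of_nat n) - ?Q (z + of_nat n)) / (?e z - 1)) = 
           (\<Sum>n<c. ?Q (z + of_nat (Suc n)) - ?Q (z + of_nat n)) / (?e z - 1)"
        by (simp add: sum_divide_distrib add_ac)
      also have "\<dots> = (?Q (z + of_nat c) - ?Q z) / (?e z - 1)"
        by (subst sum_lessThan_telescope) simp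
      also have "\<dots> = ?Q z * ((?e z ^ A - 1) / (?e z - 1))"
        by (simp add: per algebra_simps)
      also have "\<dots> = (\<Sum>m<A. ?Q z * ?e z ^ m)"
        unfolding geometric_sum[OF \<open>?e z \<noteq> 1\<close>, of A, symmetric] by (rule sum_distrib_left)
      also have "\<dots> = (\<Sum>m<A. quad_exp \<alpha> (\<beta> + 2 * of_real pi * of_nat m) 0 z)"
        by (intro sum.cong refl) (simp add: quad_exp_def exp_of_nat_mult[symmetric] exp_add[symmetric] algebra_simps)
      finally show "(\<Sum>n<c. (?Q (z + 1 + of_nat n) - ?Q (z + of_nat n)) / (?e z - 1)) = 
         (\<Sum>m<A. quad_exp \<alpha> (\<beta> + 2 * of_real pi * of_nat m) 0 z)" .
    qed simp
    also have "\<dots> = (\<Sum>m<A. contour_integral (?L T) (quad_exp \<alpha> (\<beta> + 2 * of_real pi * of_nat m) 0))"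
      by (intro contour_integral_sum contour_integrable_continuous_linepath)
        (auto simp: quad_exp_def intro!: continuous_intros)
    finally show ?thesis .
  qed
  from tendsto_unique[OF _ 1[unfolded this] 2]
  have "(\<Sum>n<c. ?Q (0 + of_nat n)) =
     (\<Sum>m<A. (1 + \<i>) * of_real (sqrt (pi / (2 * \<alpha>))) * exp (\<i> * 0 - \<i> * (\<beta> + 2 * of_real pi * of_nat m)\<^sup>2 / (4 * of_real \<alpha>)))"
    by simp
  moreover have "?Q (0 + of_nat n) = exp (of_real pi * \<i> * (of_nat A * (of_nat n)\<^sup>2 + of_int B * of_nat n) / of_nat c)" for n
    by (simp add: quad_exp_def \<alpha>_def \<beta>_def add_divide_distrib algebra_simps)
  moreover have "(1 + \<i>) * of_real (sqrt (pi / (2 * \<alpha>))) = of_real (sqrt (c / A)) * exp (of_real pi * \<i> / 4)"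
  proof -
    have "exp (of_real pi * \<i> / 4) = cis (pi / 4)" by (simp add: cis_conv_exp mult.commute)
    also have "\<dots> = of_real (1 / sqrt 2) * (1 + \<i>)"
      by (simp add: complex_eq_iff cos_45 sin_45 real_div_sqrt field_simps)
    finally have "exp (of_real pi * \<i> / 4) = of_real (1 / sqrt 2) * (1 + \<i>)" .
    moreover have "sqrt (pi / (2 * \<alpha>)) = sqrt (c / A) * (1 / sqrt 2)"
      using assms by (simp add: \<alpha>_def real_sqrt_mult[symmetric] real_sqrt_divide[symmetric])
    ultimately show ?thesis by (simp add: mult_ac)
  qed
  moreover have "\<i> * 0 - \<i> * (\<beta> + 2 * of_real pi * of_nat m)\<^sup>2 / (4 * of_real \<alpha>)
      = - of_real pi * \<i> * (of_int B + 2 * of_nat m * of_nat c)\<^sup>2 / (4 * of_nat A * of_nat c)" for m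
  proof -
    have "\<beta> + 2 * of_real pi * of_nat m = of_real pi * (of_int B + 2 * of_nat m * of_nat c) / of_nat c"
      using assms by (simp add: \<beta>_def field_simps)
    then have sq: "(\<beta> + 2 * of_real pi * of_nat m)\<^sup>2 = (of_real pi)\<^sup>2 * (of_int B + 2 * of_nat m * of_nat c)\<^sup>2 / (of_nat c)\<^sup>2"
      by (simp add: power_divide power_mult_distrib)
    show ?thesis unfolding sq using assms by (simp add: \<alpha>_def power2_eq_square mult_ac)
  qed
  ultimately show ?thesis by (simp add: sum_distrib_left)
qed

text \<open>
For \<open>b < 0\<close> this is the reciprocity law with \<open>A = \<bar>b\<bar>\<close> and modulus \<open>2 r\<close>, for
\<open>b > 0\<close> its complex conjugate.
\<close>

lemma twisted_gauss_sum_reciprocity: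
  fixes b c :: int and r :: nat
  assumes "b \<noteq> 0" "r > 0"
  shows "(\<Sum>m<2*r. exp (- (of_real pi * \<i> * (of_int b * (of_nat m)\<^sup>2 + 2 * of_int (sgn b) * of_int c * of_nat m) / (2 * of_nat r))))
    = 2 * of_real (sqrt (real r / (2 * real_of_int \<bar>b\<bar>))) * exp (- (of_real pi * \<i> * of_int (sgn b)) / 4)
       * (\<Sum>n<nat \<bar>b\<bar>. exp (2 * of_real pi * \<i> * of_nat r * ((of_nat n)\<^sup>2 / of_int b)) *
            exp (2 * of_real pi * \<i> * ((of_int c)\<^sup>2 / (4 * of_int b * of_nat r) + of_int c * of_nat n / of_int b)))"
proof -
  define A where "A = nat \<bar>b\<bar>"
  have A: "A > 0" "real A = real_of_int \<bar>b\<bar>" using assms by (auto simp: A_def)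
  have sq: "sqrt (real (2 * r) / real A) = 2 * sqrt (real r / (2 * real_of_int \<bar>b\<bar>))"
  proof -
    have "real (2 * r) / real A = 2\<^sup>2 * (real r / (2 * real_of_int \<bar>b\<bar>))"
      by (simp add: A)
    then show ?thesis by (simp only: real_sqrt_mult real_sqrt_abs abs_numeral)
  qed
  show ?thesis
  proof (cases "b > 0")
    case True
    then have b: "b = int A" "sgn b = 1" "\<bar>b\<bar> = int A" by (auto simp: A_def)
    have "even (int A * int (2 * r) + 2 * c)" by simp
    from arg_cong[OF quadratic_gauss_sum_reciprocity[OF A(1) _ this], of cnj] assms
    have sum: "(\<Sum>m<2*r. exp (- (of_real pi * \<i> * (of_nat A * (of_nat m)\<^sup>2 + 2 * of_int c * of_nat m) / (2 * of_nat r))))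
       = of_real (sqrt (real (2 * r) / real A)) * exp (- (of_real pi * \<i>) / 4) *
         (\<Sum>m<A. exp (of_real pi * \<i> * (2 * of_int c + 4 * of_nat m * of_nat r)\<^sup>2 / (8 * of_nat A * of_nat r)))"
      by (simp add: exp_cnj mult.assoc)
    have rhs: "exp (of_real pi * \<i> * (2 * of_int c + 4 * of_nat m * of_nat r)\<^sup>2 / (8 * of_nat A * of_nat r))
      = exp (2 * of_real pi * \<i> * of_nat r * ((of_nat m)\<^sup>2 / of_int b)) *
            exp (2 * of_real pi * \<i> * ((of_int c)\<^sup>2 / (4 * of_int b * of_nat r) + of_int c * of_nat m / of_int b))" for m
      unfolding exp_add[symmetric] b
      by (rule arg_cong[of _ _ exp]) (use A(1) assms in \<open>simp add: field_simps power2_eq_square\<close>)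
    show ?thesis using sum[unfolded rhs] A(1) unfolding sq by (simp add: b)
  next
    case False
    then have b: "b = - int A" "sgn b = -1" "\<bar>b\<bar> = int A" using assms by (auto simp: A_def)
    have "even (int A * int (2 * r) + 2 * c)" by simp
    from quadratic_gauss_sum_reciprocity[OF A(1) _ this] assms
    have sum: "(\<Sum>m<2*r. exp (of_real pi * \<i> * (of_nat A * (of_nat m)\<^sup>2 + 2 * of_int c * of_nat m) / (2 * of_nat r)))
       = of_real (sqrt (real (2 * r) / real A)) * exp (of_real pi * \<i> / 4) *
         (\<Sum>m<A. exp (- (of_real pi * \<i> * (2 * of_int c + 4 * of_nat m * of_nat r)\<^sup>2 / (8 * of_nat A * of_nat r))))"
      by (simp add: mult.assoc)
    have rhs: "exp (- (of_real pi * \<i> * (2 * of_int c + 4 * of_nat m * of_nat r)\<^sup>2 / (8 * of_nat A * of_nat r)))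
      = exp (2 * of_real pi * \<i> * of_nat r * ((of_nat m)\<^sup>2 / of_int b)) *
            exp (2 * of_real pi * \<i> * ((of_int c)\<^sup>2 / (4 * of_int b * of_nat r) + of_int c * of_nat m / of_int b))" for m
      unfolding exp_add[symmetric] b
      by (rule arg_cong[of _ _ exp]) (use A(1) assms in \<open>simp add: field_simps power2_eq_square\<close>)
    have lhs: "of_real pi * \<i> * (of_nat A * (of_nat m)\<^sup>2 + 2 * of_int c * of_nat m) / (2 * of_nat r)
       = - (of_real pi * \<i> * (of_int b * (of_nat m)\<^sup>2 + 2 * of_int (sgn b) * of_int c * of_nat m) / (2 * of_nat r))" for m :: nat
      using A(1) assms(2) by (simp add: b field_simps)
    show ?thesis using sum[unfolded rhs lhs] A(1) unfolding sq by (simp add: b)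
  qed
qed

text \<open>
The involution \<open>m \<mapsto> 2 r - m\<close> exchanges the two halves of a period and fixes only 0 and \<open>r\<close>
modulo \<open>2 r\<close>.
\<close>

lemma sum_even_periodic:
  fixes f :: "int \<Rightarrow> 'a :: comm_semiring_1"
  assumes even: "\<And>x. f (- x) = f x" and per: "\<And>x. f (x + 2 * int r) = f x" and "r > 0"
  shows "(\<Sum>m<2*r. f (int m)) = f 0 + f (int r) + 2 * (\<Sum>m=1..<r. f (int m))"
proof -
  have "(\<Sum>m<2*r. f (int m)) = (\<Sum>m<r. f (int m)) + (\<Sum>m=r..<2*r. f (int m))"
    using sum.atLeastLessThan_concat[of 0 r "2*r" "\<lambda>m. f (int m)"] by (simp add: atLeast0LessThan)
  also have "(\<Sum>m<r. f (int m)) = f 0 + (\<Sum>m=1..<r. f (int m))"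
    using \<open>r > 0\<close> by (simp add: atLeast0LessThan[symmetric] sum.atLeast_Suc_lessThan)
  also have "(\<Sum>m=r..<2*r. f (int m)) = f (int r) + (\<Sum>m=Suc r..<2*r. f (int m))"
    using \<open>r > 0\<close> by (simp add: sum.atLeast_Suc_lessThan)
  also have "(\<Sum>m=Suc r..<2*r. f (int m)) = (\<Sum>m=1..<r. f (int m))"
  proof (rule sum.reindex_bij_witness[of _ "\<lambda>m. 2 * r - m" "\<lambda>m. 2 * r - m"])
    fix m assume m: "m \<in> {Suc r..<2*r}"
    then have "int (2 * r - m) = - int m + 2 * int r" by auto
    then show "f (int (2 * r - m)) = f (int m)" by (simp only: per even)
  qed auto
  finally show ?thesis by (simp add: algebra_simps mult_2)
qed

section \<open>The trace\<close>

text \<open>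
Multiplied by \<open>y - inverse y\<close>, the sum on the right telescopes.
\<close>

lemma quantum_integer_eq_sum:
  fixes y :: "'a :: field"
  assumes "y \<noteq> 0" "y - inverse y \<noteq> 0"
  shows "(y powi (int j + 1) - y powi (- (int j + 1))) / (y - inverse y) = (\<Sum>l=0..j. y powi (2 * int l - int j))"
proof -
  have "(\<Sum>l=0..j. y powi (2 * int l - int j)) * (y - inverse y)
     = (\<Sum>l<Suc j. y powi (2 * int (Suc l) - int j - 1) - y powi (2 * int l - int j - 1))"
    unfolding sum_distrib_right atLeast0AtMost lessThan_Suc_atMost
  proof (intro sum.cong refl)
    fix l
    have "y powi (2 * int l - int j) * y = y powi (2 * int (Suc l) - int j - 1)"
      using power_int_add[of y "2 * int l - int j" 1] assms(1) by (simp add: algebra_simps)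
    moreover have "y powi (2 * int l - int j) * inverse y = y powi (2 * int l - int j - 1)"
      using power_int_add[of y "2 * int l - int j" "-1"] assms(1) by (simp add: power_int_minus)
    ultimately show "y powi (2 * int l - int j) * (y - inverse y) = y powi (2 * int (Suc l) - int j - 1) - y powi (2 * int l - int j - 1)"
      by (simp only: right_diff_distrib)
  qed
  also have "\<dots> = y powi (2 * int (Suc j) - int j - 1) - y powi (2 * int 0 - int j - 1)"
    by (rule sum_lessThan_telescope)
  also have "\<dots> = y powi (int j + 1) - y powi (- (int j + 1))"
    by (intro arg_cong2[of _ _ _ _ minus] arg_cong[of _ _ "power_int y"]) auto
  finally show ?thesis using assms(2) by (simp add: field_simps)
qed

lemma mat_diag_nat_pow:
  "mat_diag N f [^]\<^bsub>ring_mat TYPE('a :: comm_ring_1) N ()\<^esub> (n :: nat) = mat_diag N (\<lambda>i. f i ^ n)"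
  by (induction n) (simp_all add: ring_mat_simps mat_diag_one mat_diag_diag mult.commute)

lemma mat_diag_int_pow:
  fixes f :: "nat \<Rightarrow> 'a :: field"
  assumes "\<And>i. i < N \<Longrightarrow> f i \<noteq> 0"
  shows "mat_diag N f [^]\<^bsub>ring_mat TYPE('a) N ()\<^esub> (b :: int) = mat_diag N (\<lambda>i. f i powi b)"
proof (cases "b \<ge> 0")
  case True
  then show ?thesis by (simp add: int_pow_def2 mat_diag_nat_pow power_int_def)
next
  case False
  interpret ring "ring_mat TYPE('a) N ()" by (rule ring_mat)
  let ?g = "\<lambda>i. f i ^ nat (- b)"
  have "mat_diag N ?g * mat_diag N (\<lambda>i. inverse (?g i)) = 1\<^sub>m N" "mat_diag N (\<lambda>i. inverse (?g i)) * mat_diag N ?g = 1\<^sub>m N"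
    using assms by (auto simp: mat_diag_def mat_diag_diag[unfolded mat_diag_def] one_mat_def intro!: eq_matI)
  then have "inv\<^bsub>ring_mat TYPE('a) N ()\<^esub> (mat_diag N ?g) = mat_diag N (\<lambda>i. inverse (?g i))"
    by (intro inv_char) (simp_all add: ring_mat_simps)
  then show ?thesis using False by (simp add: int_pow_def2 mat_diag_nat_pow power_int_def power_inverse)
qed

lemma mat_trace_mat_diag_mult:
  "mat_trace (mat_diag N f * mat_diag N g) = (\<Sum>n<N. f n * g n)"
  by (simp add: mat_trace_def mat_diag_diag) (simp add: mat_diag_def)

lemma skein_a_powi: "skein_a k powi e = exp (- (of_real pi * \<i> * of_int e / (2 * of_nat (k + 2))))"
proof -
  have "of_int e * (- (2 * complex_of_real pi * \<i>) / (4 * R)) = - (of_real pi * \<i> * of_int e / (2 * R))" for R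
    by (cases "R = 0") (simp_all add: field_simps)
  then show ?thesis by (simp only: skein_a_def exp_power_int)
qed

text \<open>
The eigenvalue of the curve operator is the quantum integer for \<open>y = a\<^bsup>2(n+1)\<^esup>\<close>. The
denominator vanishes only if \<open>y\<^sup>2 = 1\<close>, that is, if \<open>r\<close> divides \<open>n + 1\<close>.
\<close>

lemma curve_operator_entry:
  assumes "n < k + 1"
  shows "(skein_a k powi (2 * (int n + 1) * (int j + 1)) - skein_a k powi (- 2 * (int n + 1) * (int j + 1)))
     / (skein_a k powi (2 * (int n + 1)) - skein_a k powi (- 2 * (int n + 1)))
     = (\<Sum>l=0..j. exp (- (of_real pi * \<i> * (of_int (2 * int l - int j) * of_nat (n + 1)) / of_nat (k + 2))))"
proof -
  define y where "y = skein_a k powi (2 * (int n + 1))"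
  have y: "y powi e = skein_a k powi (2 * (int n + 1) * e)" for e
    by (simp add: y_def power_int_mult)
  have y0: "y \<noteq> 0" by (simp add: y_def skein_a_powi)
  have "y - inverse y \<noteq> 0"
  proof
    assume "y - inverse y = 0"
    then have "y powi 2 = 1" using y0 by (simp add: field_simps power2_eq_square)
    then have "exp (- (of_real pi * \<i> * of_int (2 * (int n + 1) * 2) / (2 * of_nat (k + 2)))) = (1 :: complex)"
      unfolding y skein_a_powi .
    also have "- (of_real pi * \<i> * of_int (2 * (int n + 1) * 2) / (2 * R)) = 2 * of_real pi * \<i> * (- (of_nat (n + 1) / R))" for R
      by (cases "R = 0") (simp_all add: field_simps)
    finally have "- (of_nat (n + 1) / of_nat (k + 2) :: complex) \<in> \<int>" by (simp only: exp_2pi_eq_1_iff)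
    moreover have "- (of_nat (n + 1) / of_nat (k + 2)) = complex_of_real (- (real (n + 1) / real (k + 2)))"
      by simp
    ultimately have "complex_of_real (- (real (n + 1) / real (k + 2))) \<in> \<int>" by (simp only:)
    then obtain z where "complex_of_real (- (real (n + 1) / real (k + 2))) = of_int z" by (elim Ints_cases)
    then have "- (real (n + 1) / real (k + 2)) = of_int z" by (metis of_real_eq_iff of_real_of_int_eq)
    moreover have "- (real (n + 1) / real (k + 2)) < 0" "- (real (n + 1) / real (k + 2)) > -1"
      using assms by (simp_all add: field_simps)
    ultimately show False by simp
  qed
  from quantum_integer_eq_sum[OF y0 this, of j]
  have quot: "(y powi (int j + 1) - y powi (- (int j + 1))) / (y - inverse y) = (\<Sum>l=0..j. y powi (2 * int l - int j))" .
  have inv: "inverse y = skein_a k powi (- 2 * (int n + 1))" by (simp add: y_def power_int_minus[symmetric])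
  have weight: "y powi (2 * int l - int j) = exp (- (of_real pi * \<i> * (of_int (2 * int l - int j) * of_nat (n + 1)) / of_nat (k + 2)))" for l
  proof -
    have "- (of_real pi * \<i> * of_int (2 * (int n + 1) * (2 * int l - int j)) / (2 * R))
        = - (of_real pi * \<i> * (of_int (2 * int l - int j) * of_nat (n + 1)) / R)" for R
      by (cases "R = 0") (simp_all add: field_simps)
    then show ?thesis by (simp only: y skein_a_powi)
  qed
  have neg: "- 2 * (int n + 1) * (int j + 1) = 2 * (int n + 1) * (- (int j + 1))"
    by (simp add: algebra_simps)
  show ?thesis
    unfolding neg inv[symmetric] y[symmetric] y_def[symmetric] quot weight ..
qed

theorem theorem3p1p3:
  fixes b :: int and j k r :: nat
  assumes "b \<noteq> 0" and "j \<le> k" and "r = k + 2"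
  shows "Z_SU2 k b j =
    exp (complex_of_real pi * \<i> * of_int b / (2 * of_nat r)) *
    (complex_of_real (sqrt (real r / (2 * real_of_int \<bar>b\<bar>)))
       * exp (- (complex_of_real pi * \<i> * of_int (sgn b)) / 4)
       * (\<Sum>n<nat \<bar>b\<bar>.
            exp (2 * complex_of_real pi * \<i> * of_nat r * ((of_nat n)\<^sup>2 / of_int b)) *
            (\<Sum>l=0..j.
               exp (2 * complex_of_real pi * \<i> *
                 ((2 * of_nat l - of_nat j)\<^sup>2 / (4 * of_int b * of_nat r)
                  + (2 * of_nat l - of_nat j) * of_nat n / of_int b))))
     - (of_nat j + 1) / 2
     - (-1) ^ j * (of_nat j + 1) / 2
         * exp (- (complex_of_real pi * \<i> / 2) * of_int b * of_nat r))"
proof -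
  have "r > 0" using assms by simp
  \<comment> \<open>The numbers \<open>w l\<close> are the weights of the representation of dimension \<open>j + 1\<close>, and \<open>h x\<close> is its
     character; up to a common factor the trace is the sum of
     \<open>f (n + 1)\<close> over the colours \<open>n\<close>.\<close>
  define w :: "nat \<Rightarrow> int" where "w l = 2 * int l - int j" for l
  define h :: "int \<Rightarrow> complex" where
    "h x = (\<Sum>l=0..j. exp (- (of_real pi * \<i> * (of_int (w l) * of_int x) / of_nat r)))" for x
  define f where "f x = exp (- (of_real pi * \<i> * of_int b * (of_int x)\<^sup>2 / (2 * of_nat r))) * h x" for x
  have h_even: "h (- x) = h x" for x
    unfolding h_def by (subst sum.atLeastAtMost_rev) (intro sum.cong refl, auto simp: w_def of_nat_diff algebra_simps)
  have f_even: "f (- x) = f x" for x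
    by (simp add: f_def h_even)
  have expI: "exp (z - 2 * of_real pi * \<i> * of_int m) = exp z" for z :: complex and m
  proof -
    have "exp (2 * of_real pi * \<i> * of_int m) = (1 :: complex)" by (subst exp_2pi_eq_1_iff) simp
    then show ?thesis by (simp only: exp_diff div_by_1)
  qed
  have f_per: "f (x + 2 * int r) = f x" for x
  proof -
    have "- (of_real pi * \<i> * (of_int (w l) * of_int (x + 2 * int r)) / of_nat r) =
        - (of_real pi * \<i> * (of_int (w l) * of_int x) / of_nat r) - 2 * of_real pi * \<i> * of_int (w l)" for l
      using \<open>r > 0\<close> by (simp add: field_simps)
    then have "h (x + 2 * int r) = h x" by (simp only: h_def expI)
    moreover have "- (of_real pi * \<i> * of_int b * (of_int (x + 2 * int r))\<^sup>2 / (2 * of_nat r))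
       = - (of_real pi * \<i> * of_int b * (of_int x)\<^sup>2 / (2 * of_nat r)) - 2 * of_real pi * \<i> * of_int (b * x + b * int r)"
      using \<open>r > 0\<close> by (simp add: field_simps power2_eq_square)
    ultimately show ?thesis by (simp only: f_def expI)
  qed
  \<comment> \<open>The two fixed points of \<open>x \<mapsto> - x\<close> modulo \<open>2 r\<close> give the two correction terms.\<close>
  have f_0: "f 0 = of_nat j + 1"
    by (simp add: f_def h_def)
  have f_r: "f (int r) = (-1) ^ j * (of_nat j + 1) * exp (- (of_real pi * \<i> / 2) * of_int b * of_nat r)"
  proof -
    have "exp (- (of_real pi * \<i> * (of_int (w l) * of_int (int r)) / of_nat r)) = (-1) ^ j" for l
    proof -
      have "- (of_real pi * \<i> * (of_int (w l) * of_int (int r)) / of_nat r) = of_nat j * (of_real pi * \<i>) - 2 * of_real pi * \<i> * of_int (int l)"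
        using \<open>r > 0\<close> by (simp add: w_def field_simps)
      then show ?thesis by (simp only: expI exp_of_nat_mult exp_pi_i)
    qed
    then have "h (int r) = (-1) ^ j * (of_nat j + 1)" by (simp add: h_def)
    moreover have "- (of_real pi * \<i> * of_int b * (of_int (int r))\<^sup>2 / (2 * of_nat r)) = - (of_real pi * \<i> / 2) * of_int b * of_nat r"
      using \<open>r > 0\<close> by (simp add: field_simps power2_eq_square)
    ultimately show ?thesis by (simp only: f_def) (rule mult.commute)
  qed
  have trace: "Z_SU2 k b j = exp (of_real pi * \<i> * of_int b / (2 * of_nat r)) * (\<Sum>m=1..<r. f (int m))"
  proof -
    have "skein_a k \<noteq> 0" by (simp add: skein_a_def)
    then have "Z_SU2 k b j = (\<Sum>n<k+1. (skein_a k ^ (n\<^sup>2 + 2 * n)) powi b * 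
       ((skein_a k powi (2 * (int n + 1) * (int j + 1)) - skein_a k powi (- 2 * (int n + 1) * (int j + 1)))
     / (skein_a k powi (2 * (int n + 1)) - skein_a k powi (- 2 * (int n + 1)))))"
      unfolding Z_SU2_def Z_mapping_torus_def rho_twist_def curve_operator_def
      by (subst mat_diag_int_pow) (simp_all only: mat_trace_mat_diag_mult power_not_zero not_False_eq_True)
    also have "\<dots> = (\<Sum>n<k+1. exp (of_real pi * \<i> * of_int b / (2 * of_nat r)) * f (int (n + 1)))"
    proof (rule sum.cong[OF refl])
      fix n assume "n \<in> {..<k+1}"
      then have n: "n < k + 1" by simp
      have "(skein_a k ^ (n\<^sup>2 + 2 * n)) powi b = skein_a k powi (int (n\<^sup>2 + 2 * n) * b)"
        by (simp only: power_int_mult power_int_of_nat)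
      also have "\<dots> = exp (of_real pi * \<i> * of_int b / (2 * of_nat r)) * exp (- (of_real pi * \<i> * of_int b * (of_int (int (n + 1)))\<^sup>2 / (2 * of_nat r)))"
        unfolding skein_a_powi exp_add[symmetric] assms(3)
        by (rule arg_cong[of _ _ exp]) (simp add: field_simps power2_eq_square del: of_nat_Suc of_nat_add, simp add: algebra_simps)
      finally have *: "(skein_a k ^ (n\<^sup>2 + 2 * n)) powi b = \<dots>" .
      show "(skein_a k ^ (n\<^sup>2 + 2 * n)) powi b * 
       ((skein_a k powi (2 * (int n + 1) * (int j + 1)) - skein_a k powi (- 2 * (int n + 1) * (int j + 1)))
     / (skein_a k powi (2 * (int n + 1)) - skein_a k powi (- 2 * (int n + 1)))) = exp (of_real pi * \<i> * of_int b / (2 * of_nat r)) * f (int (n + 1))"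
        unfolding * curve_operator_entry[OF n] f_def h_def w_def assms(3) by (simp only: mult.assoc of_int_of_nat_eq)
    qed
    also have "\<dots> = exp (of_real pi * \<i> * of_int b / (2 * of_nat r)) * (\<Sum>n<k+1. f (int (n + 1)))"
      by (rule sum_distrib_left[symmetric])
    also have "(\<Sum>n<k+1. f (int (n + 1))) = (\<Sum>m=1..<r. f (int m))"
      using sum.shift_bounds_nat_ivl[of "\<lambda>m. f (int m)" 0 1 "k+1"] assms(3) by (simp add: atLeast0LessThan)
    finally show ?thesis .
  qed
  let ?q = "complex_of_real (sqrt (real r / (2 * real_of_int \<bar>b\<bar>))) * exp (- (complex_of_real pi * \<i> * of_int (sgn b)) / 4)"
  let ?E = "\<lambda>n. exp (2 * complex_of_real pi * \<i> * of_nat r * ((of_nat n)\<^sup>2 / of_int b))"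
  let ?R = "\<lambda>n l. exp (2 * complex_of_real pi * \<i> * ((2 * of_nat l - of_nat j)\<^sup>2 / (4 * of_int b * of_nat r)
                  + (2 * of_nat l - of_nat j) * of_nat n / of_int b))"
  \<comment> \<open>The sign of \<open>b\<close> may be put into the character because the weights are symmetric; this is the
     form in which the reciprocity gives the linear term the same sign for both signs of \<open>b\<close>.\<close>
  have f_sgn: "f (int m) = (\<Sum>l=0..j. exp (- (of_real pi * \<i> * (of_int b * (of_nat m)\<^sup>2 + 2 * of_int (sgn b) * of_int (w l) * of_nat m) / (2 * of_nat r))))" for m
  proof -
    have h_sgn: "h (int m) = h (sgn b * int m)"
      using assms(1) h_even by (cases "b > 0") (auto simp: sgn_if)
    show ?thesis
      unfolding f_def h_sgn unfolding h_def sum_distrib_left exp_add[symmetric]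
      by (intro sum.cong refl arg_cong[of _ _ exp], use \<open>r > 0\<close> in \<open>simp add: field_simps\<close>)
  qed
  have "(\<Sum>m<2*r. f (int m)) = (\<Sum>l=0..j. 2 * ?q * (\<Sum>n<nat \<bar>b\<bar>. ?E n * ?R n l))"
    unfolding f_sgn
    by (subst sum.swap, unfold twisted_gauss_sum_reciprocity[OF assms(1) \<open>r > 0\<close>]) (simp add: w_def mult.assoc)
  also have "\<dots> = 2 * (?q * (\<Sum>n<nat \<bar>b\<bar>. ?E n * (\<Sum>l=0..j. ?R n l)))"
    unfolding sum_distrib_left by (subst sum.swap) (simp only: mult.assoc)
  finally have "f 0 + f (int r) + 2 * (\<Sum>m=1..<r. f (int m)) = 2 * (?q * (\<Sum>n<nat \<bar>b\<bar>. ?E n * (\<Sum>l=0..j. ?R n l)))"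
    unfolding sum_even_periodic[of f, OF f_even f_per \<open>r > 0\<close>] .
  moreover have "s = Y - a / 2 - c / 2" if "a + c + 2 * s = 2 * Y" for a c s Y :: complex
  proof -
    have "s = ((a + c + 2 * s) - a - c) / 2" by simp
    then show ?thesis unfolding that by (simp add: diff_divide_distrib)
  qed
  ultimately have "(\<Sum>m=1..<r. f (int m)) = ?q * (\<Sum>n<nat \<bar>b\<bar>. ?E n * (\<Sum>l=0..j. ?R n l)) - f 0 / 2 - f (int r) / 2"
    by blast
  then show ?thesis unfolding trace f_0 f_r by (simp only: mult.assoc times_divide_eq_left)
qed

end
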